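(* Let $\mathcal C_1,\dots,\mathcal C_T\subseteq\mathbb R^d$ be arbitrary nonempty closed convex sets, with Euclidean projections $\Pi_m(\mathbf w)=\operatorname{argmin}_{\mathbf v\in\mathcal C_m}\|\mathbf v-\mathbf w\|$. Let $\mathbf w_0\in\mathbb R^d$, let $\tau:\{1,\dots,k\}\to\{1,\dots,T\}$ be any ordering, and define the iterates $\mathbf w_t=\Pi_{\tau(t)}(\mathbf w_{t-1})$, $t=1,\dots,k$. Define $f_m(\mathbf w)=\frac12\|\mathbf w-\Pi_m(\mathbf w)\|^2$ for $m\in\{1,\dots,T\}$. Then: (i) each $f_m$ is convex and $1$-smooth; (ii) for every $t\in\{1,\dots,k\}$, $\ \mathbf w_t=\Pi_{\tau(t)}(\mathbf w_{t-1})=\mathbf w_{t-1}-\nabla f_{\tau(t)}(\mathbf w_{t-1})$.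
   Context: $\|\cdot\|$ is the Euclidean norm. A differentiable function $f$ is $\beta$-smooth if $\|\nabla f(\mathbf w)-\nabla f(\mathbf z)\|\le\beta\|\mathbf w-\mathbf z\|$ for all $\mathbf w,\mathbf z$. *)

theory Defs
  imports "HOL-Analysis.Analysis"
begin

text \<open>The gradient is unique where it exists; at points where \<open>f\<close> is not differentiable
  the value is unspecified, so \<open>smooth_fun\<close> requires differentiability separately.\<close>

definition grad :: "('a::real_inner \<Rightarrow> real) \<Rightarrow> 'a \<Rightarrow> 'a"
  where "grad f x = (THE D. GDERIV f x :> D)"

definition smooth_fun :: "real \<Rightarrow> ('a::real_inner \<Rightarrow> real) \<Rightarrow> bool"
  where "smooth_fun \<beta> f \<longleftrightarrow>
    (\<forall>w. f differentiable (at w)) \<and>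
    (\<forall>w z. norm (grad f w - grad f z) \<le> \<beta> * norm (w - z))"

text \<open>The Euclidean projection onto \<open>S\<close> is \<^const>\<open>closest_point\<close> \<open>S\<close>, an (on nonempty closed
  convex sets, the) minimizer of the distance over \<open>S\<close>.\<close>

definition half_sqdist :: "'a::euclidean_space set \<Rightarrow> 'a \<Rightarrow> real"
  where "half_sqdist S w = 1 / 2 * (norm (w - closest_point S w))\<^sup>2"

primrec proj_iterate ::
  "(nat \<Rightarrow> 'a::euclidean_space set) \<Rightarrow> (nat \<Rightarrow> nat) \<Rightarrow> 'a \<Rightarrow> nat \<Rightarrow> 'a"
  where
    "proj_iterate C \<tau> w0 0 = w0"
  | "proj_iterate C \<tau> w0 (Suc t) = closest_point (C (\<tau> (Suc t))) (proj_iterate C \<tau> w0 t)"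

end

(* Write p = P(x) for the projection of x onto S. The obtuse-angle criterion (x - p) . (y - p) \<le> 0
   for y in S gives the lower bound f(y) \<ge> f(x) + (y - x) . (x - p) for the half squared distance f,
   and comparing y with the competitor p gives the matching upper bound up to |y - x|^2 / 2.
   The lower bound is a supporting hyperplane at every point, hence f is convex; both together
   show that x - p is the gradient. Its 1-Lipschitz continuity is the same criterion used twice. *)

theory Submission
  imports Defs
begin

text \<open>Derivatives are unique and a vector is determined by its inner products, so the definite
  description in \<open>grad\<close> picks out \<open>D\<close>.\<close>

lemma grad_eqI:
  assumes "GDERIV f x :> D"
  shows "grad f x = D"
  unfolding grad_def
proof (rule the_equality, rule assms)
  fix E assume "GDERIV f x :> E"
  with assms have "(\<lambda>h. inner h E) = (\<lambda>h. inner h D)"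
    unfolding gderiv_def by (rule has_derivative_unique[rotated])
  then have "inner h E = inner h D" for h
    by (rule fun_cong)
  then show "E = D"
    using vector_eq_ldot by blast
qed

lemma GDERIV_quadratic_boundI:
  fixes f :: "'a::real_inner \<Rightarrow> real"
  assumes "\<And>y. \<bar>f y - f x - inner (y - x) D\<bar> \<le> c * (norm (y - x))\<^sup>2"
  shows "GDERIV f x :> D"
  unfolding gderiv_def
\<comment> \<open>Dividing the quadratic remainder by \<open>norm (y - x)\<close> leaves
  \<open>H\<close>. The bound is global, so the radius \<open>e = 1\<close> is arbitrary.\<close>
proof (rule has_derivativeI_sandwich[where e = 1 and H = "\<lambda>y. c * norm (y - x)"])
  show "((\<lambda>y. c * norm (y - x)) \<longlongrightarrow> 0) (at x)"
    by (rule tendsto_eq_intros refl | simp)+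
next
  fix y assume "y \<noteq> x"
  then show "norm (f y - f x - inner (y - x) D) / norm (y - x) \<le> c * norm (y - x)"
    using assms[of y] by (simp add: divide_le_eq power2_eq_square mult.assoc)
qed (simp_all add: bounded_linear_inner_left)

lemma convex_on_UNIV_subgradientI:
  fixes f :: "'a::real_inner \<Rightarrow> real"
  assumes "\<And>x y. f x + inner (y - x) (g x) \<le> f y"
  shows "convex_on UNIV f"
proof (rule convex_onI)
  fix t :: real and x y :: 'a
  assume t: "0 < t" "t < 1"
  define z where "z = (1 - t) *\<^sub>R x + t *\<^sub>R y"
  \<comment> \<open>In the weighted sum of the support inequalities at \<open>z\<close>, evaluated
    at \<open>x\<close> and \<open>y\<close>, this cancels the linear terms.\<close>
  have "(1 - t) *\<^sub>R (x - z) + t *\<^sub>R (y - z) = 0"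
    by (simp add: z_def algebra_simps)
  then have "inner ((1 - t) *\<^sub>R (x - z) + t *\<^sub>R (y - z)) (g z) = 0"
    by simp
  then have "(1 - t) * inner (x - z) (g z) + t * inner (y - z) (g z) = 0"
    by (simp only: inner_add_left inner_scaleR_left)
  moreover have "(1 - t) * (f z + inner (x - z) (g z)) \<le> (1 - t) * f x"
    "t * (f z + inner (y - z) (g z)) \<le> t * f y"
    using t assms by (simp_all add: mult_left_mono)
  ultimately show "f ((1 - t) *\<^sub>R x + t *\<^sub>R y) \<le> (1 - t) * f x + t * f y"
    unfolding z_def[symmetric] by (simp add: algebra_simps)
qed simp

context
  fixes S :: "'a::euclidean_space set"
  assumes S: "S \<noteq> {}" "closed S" "convex S"
begin

text \<open>With \<open>u = x - p\<close> and \<open>v = y - q\<close>, right side minus left side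
  equals \<open>1/2 * (norm (v - u))\<^sup>2 - inner u (q - p)\<close>, and both terms are
  nonnegative.\<close>

lemma half_sqdist_lower_bound:
  "half_sqdist S x + inner (y - x) (x - closest_point S x) \<le> half_sqdist S y"
proof -
  define p q where "p = closest_point S x" and "q = closest_point S y"
  have "inner (x - p) (q - p) \<le> 0"
    unfolding p_def q_def using S by (intro closest_point_dot closest_point_in_set)
  moreover have "0 \<le> inner ((y - q) - (x - p)) ((y - q) - (x - p))"
    by simp
  ultimately show ?thesis
    unfolding half_sqdist_def p_def[symmetric] q_def[symmetric] power2_norm_eq_inner
    by (simp add: inner_commute algebra_simps)
qed

lemma half_sqdist_upper_bound:
  "half_sqdist S y \<le> half_sqdist S x + inner (y - x) (x - closest_point S x)
    + 1 / 2 * (norm (y - x))\<^sup>2"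
proof -
  define p where "p = closest_point S x"
  have "norm (y - closest_point S y) \<le> norm (y - p)"
    using closest_point_le[of S p y] closest_point_in_set[of S x] S by (simp add: p_def dist_norm)
  then have "half_sqdist S y \<le> 1 / 2 * (norm (y - p))\<^sup>2"
    by (simp add: half_sqdist_def power_mono)
  \<comment> \<open>Expanding the square of \<open>y - p = (y - x) + (x - p)\<close> gives exactly
    the right-hand side.\<close>
  then show ?thesis
    unfolding half_sqdist_def[of S x] p_def[symmetric] power2_norm_eq_inner
    by (simp add: inner_commute algebra_simps)
qed

lemma convex_on_half_sqdist: "convex_on UNIV (half_sqdist S)"
  by (rule convex_on_UNIV_subgradientI[OF half_sqdist_lower_bound])

lemma GDERIV_half_sqdist: "GDERIV (half_sqdist S) x :> (x - closest_point S x)"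
proof (rule GDERIV_quadratic_boundI[where c = "1 / 2"])
  fix y
  show "\<bar>half_sqdist S y - half_sqdist S x - inner (y - x) (x - closest_point S x)\<bar>
      \<le> 1 / 2 * (norm (y - x))\<^sup>2"
    using half_sqdist_lower_bound[of x y] half_sqdist_upper_bound[of y x] by (simp add: abs_le_iff)
qed

lemma grad_half_sqdist: "grad (half_sqdist S) x = x - closest_point S x"
  by (rule grad_eqI[OF GDERIV_half_sqdist])

text \<open>For the residuals \<open>u = x - p\<close> and \<open>v = y - q\<close>, the two
  criteria add up to \<open>inner (u - v) (p - q) \<ge> 0\<close>. Hence expanding the square of
  \<open>x - y = (u - v) + (p - q)\<close> adds only nonnegative terms to that of
  \<open>u - v\<close>.\<close>

lemma norm_diff_closest_point_residuals_le:
  "norm ((x - closest_point S x) - (y - closest_point S y)) \<le> norm (x - y)"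
proof -
  define p q where "p = closest_point S x" and "q = closest_point S y"
  have "inner (x - p) (q - p) \<le> 0" "inner (y - q) (p - q) \<le> 0"
    unfolding p_def q_def using S by (auto intro!: closest_point_dot closest_point_in_set)
  moreover have "0 \<le> inner (p - q) (p - q)"
    by simp
  ultimately show ?thesis
    unfolding p_def[symmetric] q_def[symmetric] norm_le
    by (simp add: inner_commute algebra_simps)
qed

lemma smooth_fun_half_sqdist: "smooth_fun 1 (half_sqdist S)"
  using GDERIV_half_sqdist norm_diff_closest_point_residuals_le
  unfolding smooth_fun_def grad_half_sqdist gderiv_def by (auto simp: differentiable_def)

end

theorem mainTheorem6:
  fixes C :: "nat \<Rightarrow> (real ^ 'd) set"
    and T k :: nat
    and \<tau> :: "nat \<Rightarrow> nat"
    and w0 :: "real ^ 'd"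
  assumes "\<And>m. m \<in> {1..T} \<Longrightarrow> C m \<noteq> {}"
    and "\<And>m. m \<in> {1..T} \<Longrightarrow> closed (C m)"
    and "\<And>m. m \<in> {1..T} \<Longrightarrow> convex (C m)"
    and "\<tau> \<in> {1..k} \<rightarrow> {1..T}"
  shows "(\<forall>m\<in>{1..T}. convex_on UNIV (half_sqdist (C m)) \<and> smooth_fun 1 (half_sqdist (C m))) \<and>
    (\<forall>t\<in>{1..k}.
      proj_iterate C \<tau> w0 t = closest_point (C (\<tau> t)) (proj_iterate C \<tau> w0 (t - 1)) \<and>
      closest_point (C (\<tau> t)) (proj_iterate C \<tau> w0 (t - 1)) =
        proj_iterate C \<tau> w0 (t - 1)
        - grad (half_sqdist (C (\<tau> t))) (proj_iterate C \<tau> w0 (t - 1)))"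
proof (intro conjI ballI)
  fix m assume "m \<in> {1..T}"
  then show "convex_on UNIV (half_sqdist (C m))" "smooth_fun 1 (half_sqdist (C m))"
    using assms(1-3) by (simp_all add: convex_on_half_sqdist smooth_fun_half_sqdist)
next
  fix t assume t: "t \<in> {1..k}"
  then show "proj_iterate C \<tau> w0 t = closest_point (C (\<tau> t)) (proj_iterate C \<tau> w0 (t - 1))"
    \<comment> \<open>The range excludes \<open>t = 0\<close>, where \<open>t - 1\<close> would
      truncate; the successor case is the recursion equation.\<close>
    by (cases t) simp_all
  have "\<tau> t \<in> {1..T}"
    using t assms(4) by blast
  then show "closest_point (C (\<tau> t)) (proj_iterate C \<tau> w0 (t - 1)) =
      proj_iterate C \<tau> w0 (t - 1)
      - grad (half_sqdist (C (\<tau> t))) (proj_iterate C \<tau> w0 (t - 1))"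
    \<comment> \<open>Inserting the gradient, the step \<open>w - (w - P(w))\<close> collapses to
      \<open>P(w)\<close>.\<close>
    using assms(1-3) by (simp add: grad_half_sqdist)
qed

end
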